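(* Let $n,k\geq 1$ be integers. Then $\mathcal{F}^{(k)}(n)^{\mathrm{ab}}\cong \mathbb{Z}_\alpha\oplus\mathbb{Z}_\beta$, where $$\alpha=\gcd(F_n^k,F_{n-1}^k-1)\quad\text{and}\quad \beta=\frac{F_{n+1}^k+F_{n-1}^k-1-(-1)^n}{\alpha}.$$
   Context: For an element $w=w(x_0,\dots,x_{n-1})$ of the free group on $x_0,\dots,x_{n-1}$, the cyclically presented group $G_n(w)$ is the group with presentation $\langle x_0,\dots,x_{n-1}\mid w(x_i,x_{i+1},\dots,x_{i+n-1})\ (0\le i<n)\rangle$, subscripts taken mod $n$. The fractional Fibonacci group is $\mathcal{F}^{(k)}(n)=G_n(x_0x_1^kx_2^{-1})$ (subscripts mod $n$). $G^{\mathrm{ab}}$ denotes the abelianization of $G$, and $\mathbb{Z}_m=\mathbb{Z}/m\mathbb{Z}$. The fractional Fibonacci numbers are defined by $F_0^k=0$, $F_1^k=1$, $F_{j+2}^k=kF_{j+1}^k+F_j^k$ for $j\ge 0$ (here $k$ is a superscript index, not a power). *)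

theory Defs
  imports "HOL-Algebra.Algebra"
begin

section \<open>Free groups\<close>

text \<open>The letter \<open>(a, True)\<close> stands for the generator \<open>a\<close>, and \<open>(a, False)\<close> for its inverse.
  The elements of the free group on \<open>S\<close> are the reduced words in the letters over \<open>S\<close>, and the
  product is concatenation followed by free reduction.\<close>

type_synonym 'a word = "('a \<times> bool) list"

definition cancels :: "'a \<times> bool \<Rightarrow> 'a \<times> bool \<Rightarrow> bool" where
  "cancels x y \<longleftrightarrow> fst x = fst y \<and> snd x \<noteq> snd y"

definition reduced :: "'a word \<Rightarrow> bool" where
  "reduced w \<longleftrightarrow> successively (\<lambda>x y. \<not> cancels x y) w"

fun cons_reduce :: "'a \<times> bool \<Rightarrow> 'a word \<Rightarrow> 'a word" where
  "cons_reduce x [] = [x]"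
| "cons_reduce x (y # w) = (if cancels x y then w else x # y # w)"

definition free_group :: "'a set \<Rightarrow> 'a word monoid" where
  "free_group S =
     \<lparr>carrier = {w. set w \<subseteq> S \<times> UNIV \<and> reduced w},
      monoid.mult = (\<lambda>u v. foldr cons_reduce u v),
      one = []\<rparr>"

definition free_gen :: "'a \<Rightarrow> 'a word" where
  "free_gen a = [(a, True)]"

lemma reduced_Nil [simp]: "reduced []"
  by (simp add: reduced_def)

lemma reduced_ConsD: "reduced (x # w) \<Longrightarrow> reduced w"
  by (cases w) (auto simp: reduced_def)

lemma reduced_cons_reduce: "reduced w \<Longrightarrow> reduced (cons_reduce x w)"
  by (cases w) (auto simp: reduced_def successively_Cons)

lemma reduced_foldr: "reduced v \<Longrightarrow> reduced (foldr cons_reduce u v)"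
  by (induction u) (auto intro: reduced_cons_reduce)

lemma set_cons_reduce: "set (cons_reduce x w) \<subseteq> insert x (set w)"
  by (cases w) auto

lemma set_foldr: "set (foldr cons_reduce u v) \<subseteq> set u \<union> set v"
  using set_cons_reduce by (induction u) fastforce+

lemma cons_reduce_cancel:
  assumes "reduced w" "cancels x y"
  shows "cons_reduce x (cons_reduce y w) = w"
proof (cases w)
  case Nil
  then show ?thesis using assms by simp
next
  case (Cons z v)
  show ?thesis
  proof (cases "cancels y z")
    case True
    with assms have "x = z"
      by (auto simp: cancels_def prod_eq_iff)
    with True Cons assms show ?thesis
      by (cases v) (auto simp: reduced_def)
  next
    case False
    with Cons assms show ?thesis by simp
  qed
qed

lemma foldr_cons_reduce:
  assumes "reduced v"
  shows "foldr cons_reduce (cons_reduce x u) v = cons_reduce x (foldr cons_reduce u v)"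
  using assms by (cases u) (auto simp: cons_reduce_cancel reduced_foldr)

lemma foldr_foldr_cons_reduce:
  assumes "reduced w"
  shows "foldr cons_reduce (foldr cons_reduce u v) w = foldr cons_reduce u (foldr cons_reduce v w)"
  using assms by (induction u) (auto simp: foldr_cons_reduce)

lemma foldr_cons_reduce_Nil: "reduced w \<Longrightarrow> foldr cons_reduce w [] = w"
proof (induction w)
  case (Cons x w)
  then show ?case using reduced_ConsD[OF Cons.prems]
    by (cases w) (auto simp: reduced_def)
qed simp

lemma foldr_cons_reduce_inverse:
  "reduced v \<Longrightarrow>
    foldr cons_reduce (rev (map (\<lambda>(a, e). (a, \<not> e)) u)) (foldr cons_reduce u v) = v"
  by (induction u arbitrary: v)
    (auto simp: cons_reduce_cancel reduced_foldr cancels_def split: prod.splits)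

lemma group_free_group: "group (free_group S)"
proof (rule groupI)
  fix u v assume "u \<in> carrier (free_group S)" "v \<in> carrier (free_group S)"
  then show "u \<otimes>\<^bsub>free_group S\<^esub> v \<in> carrier (free_group S)"
    using set_foldr[of u v] by (auto simp: free_group_def reduced_foldr)
next
  fix u assume u: "u \<in> carrier (free_group S)"
  let ?v = "foldr cons_reduce (rev (map (\<lambda>(a, e). (a, \<not> e)) u)) []"
  have "?v \<in> carrier (free_group S)"
    using u set_foldr[of "rev (map (\<lambda>(a, e). (a, \<not> e)) u)" "[]"]
    by (fastforce simp: free_group_def reduced_foldr)
  moreover have "?v \<otimes>\<^bsub>free_group S\<^esub> u = \<one>\<^bsub>free_group S\<^esub>"
  proof -
    have "reduced u" using u by (simp add: free_group_def)
    then show ?thesis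
      using foldr_cons_reduce_inverse[of "[]" u] foldr_cons_reduce_Nil[of u]
      by (simp add: free_group_def foldr_foldr_cons_reduce)
  qed
  ultimately show "\<exists>v\<in>carrier (free_group S). v \<otimes>\<^bsub>free_group S\<^esub> u = \<one>\<^bsub>free_group S\<^esub>"
    by blast
qed (auto simp: free_group_def foldr_foldr_cons_reduce)


section \<open>Group presentations\<close>

definition normal_closure :: "('a, 'b) monoid_scheme \<Rightarrow> 'a set \<Rightarrow> 'a set" where
  "normal_closure G R = \<Inter>{N. N \<lhd> G \<and> R \<subseteq> N}"

definition presented_group :: "'a set \<Rightarrow> 'a word set \<Rightarrow> 'a word set monoid" where
  "presented_group S R = free_group S Mod normal_closure (free_group S) R"

definition abelianization :: "('a, 'b) monoid_scheme \<Rightarrow> 'a set monoid" where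
  "abelianization G = G Mod derived G (carrier G)"


section \<open>Cyclically presented groups\<close>

text \<open>The element of \<open>G\<close> obtained from the word \<open>w\<close> by substituting \<open>f a\<close> for each generator \<open>a\<close>.\<close>

definition word_subst :: "('b, 'c) monoid_scheme \<Rightarrow> ('a \<Rightarrow> 'b) \<Rightarrow> 'a word \<Rightarrow> 'b" where
  "word_subst G f w =
     foldr (\<lambda>(a, e) y. (if e then f a else inv\<^bsub>G\<^esub> f a) \<otimes>\<^bsub>G\<^esub> y) w \<one>\<^bsub>G\<^esub>"

text \<open>The generator \<open>x\<^sub>i\<close> with its subscript taken mod \<open>n\<close>, as an element of the free group
  on \<open>x\<^sub>0, \<dots>, x\<^bsub>n-1\<^esub>\<close>.\<close>

definition cyc_gen :: "nat \<Rightarrow> nat \<Rightarrow> nat word" where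
  "cyc_gen n i = free_gen (i mod n)"

definition cyclically_presented_group :: "nat \<Rightarrow> nat word \<Rightarrow> nat word set monoid" where
  "cyclically_presented_group n w =
     presented_group {..<n}
       ((\<lambda>i. word_subst (free_group {..<n}) (\<lambda>j. cyc_gen n (i + j)) w) ` {..<n})"

definition fractional_Fibonacci_group :: "nat \<Rightarrow> nat \<Rightarrow> nat word set monoid" where
  "fractional_Fibonacci_group k n =
     cyclically_presented_group n
       (cyc_gen n 0
        \<otimes>\<^bsub>free_group {..<n}\<^esub> (cyc_gen n 1 [^]\<^bsub>free_group {..<n}\<^esub> k)
        \<otimes>\<^bsub>free_group {..<n}\<^esub> inv\<^bsub>free_group {..<n}\<^esub> (cyc_gen n 2))"


section \<open>Fractional Fibonacci numbers\<close>

fun frac_fib :: "nat \<Rightarrow> nat \<Rightarrow> int" where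
  "frac_fib k 0 = 0"
| "frac_fib k (Suc 0) = 1"
| "frac_fib k (Suc (Suc j)) = int k * frac_fib k (Suc j) + frac_fib k j"

end

theory Submission
  imports Defs
begin

text \<open>
  In the abelianization, written additively, the relations say \<open>x\<^bsub>i+2\<^esub> = x\<^sub>i + k x\<^bsub>i+1\<^esub>\<close>, so that
  \<open>x\<^sub>i = F\<^bsub>i-1\<^esub> x\<^sub>0 + F\<^sub>i x\<^sub>1\<close>. The remaining conditions \<open>x\<^sub>n = x\<^sub>0\<close> and \<open>x\<^bsub>n+1\<^esub> = x\<^sub>1\<close> identify the
  group with the quotient of \<open>\<int>\<^sup>2\<close> by the lattice spanned by \<open>(a, b)\<close> and \<open>(b, k b + a)\<close>, where
  \<open>a = F\<^bsub>n-1\<^esub> - 1\<close> and \<open>b = F\<^sub>n\<close>. The gcd of the entries is \<open>\<alpha> = gcd a b\<close>, and by Cassini's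
  identity the determinant is \<open>-\<alpha> \<beta>\<close>. With \<open>a = \<alpha> c\<close>, \<open>b = \<alpha> d\<close> and \<open>u c + v d = 1\<close>, the map
  \<open>(p, q) \<mapsto> (p u + q v, q c - p d)\<close> induces the isomorphism onto \<open>\<int>\<^sub>\<alpha> \<oplus> \<int>\<^sub>\<beta>\<close>.
\<close>

section \<open>Homomorphisms out of free and presented groups\<close>

lemma word_subst_Nil [simp]: "word_subst G f [] = \<one>\<^bsub>G\<^esub>"
  by (simp add: word_subst_def)

lemma word_subst_Cons [simp]:
  "word_subst G f ((a, e) # w) = (if e then f a else inv\<^bsub>G\<^esub> f a) \<otimes>\<^bsub>G\<^esub> word_subst G f w"
  by (simp add: word_subst_def)

lemma (in group) word_subst_closed:
  assumes "\<And>a. a \<in> S \<Longrightarrow> f a \<in> carrier G" "set w \<subseteq> S \<times> UNIV"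
  shows "word_subst G f w \<in> carrier G"
  using assms(2)
proof (induction w)
  case (Cons x w)
  then show ?case using assms(1) by (cases x) auto
qed simp

text \<open>Substitution respects free reduction: a cancelled pair of letters contributes a factor
  and its inverse. Products of words are iterated \<open>cons_reduce\<close>, so this is the core of
  \<open>word_subst_hom\<close>.\<close>

lemma (in group) word_subst_cons_reduce:
  assumes f: "\<And>a. a \<in> S \<Longrightarrow> f a \<in> carrier G" and w: "set w \<subseteq> S \<times> UNIV" and a: "a \<in> S"
  shows "word_subst G f (cons_reduce (a, e) w) = word_subst G f ((a, e) # w)"
proof (cases w)
  case (Cons y v)
  obtain b d where y: "y = (b, d)" by (cases y)
  have cl: "f a \<in> carrier G" "f b \<in> carrier G" "word_subst G f v \<in> carrier G"
    using word_subst_closed[of S f v] f w a by (auto simp: Cons y)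
  show ?thesis
    using cl by (auto simp: Cons y cancels_def inv_solve_left m_assoc[symmetric])
qed simp

lemma (in group) word_subst_hom:
  assumes f: "\<And>a. a \<in> S \<Longrightarrow> f a \<in> carrier G"
  shows "word_subst G f \<in> hom (free_group S) G"
proof (rule homI)
  fix u assume "u \<in> carrier (free_group S)"
  then show "word_subst G f u \<in> carrier G"
    using word_subst_closed[OF f] by (auto simp: free_group_def)
next
  fix u v assume "u \<in> carrier (free_group S)" "v \<in> carrier (free_group S)"
  then have "set u \<subseteq> S \<times> UNIV" "set v \<subseteq> S \<times> UNIV"
    by (auto simp: free_group_def)
  then have "word_subst G f (foldr cons_reduce u v) = word_subst G f u \<otimes> word_subst G f v"
  proof (induction u)
    case Nil
    then show ?case using word_subst_closed[of S f v] f by simp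
  next
    case (Cons x u)
    obtain a e where x: "x = (a, e)" by (cases x)
    have "set (foldr cons_reduce u v) \<subseteq> S \<times> UNIV"
      using set_foldr[of u v] Cons.prems by auto
    then show ?case
      using Cons f word_subst_closed[of S f u] word_subst_closed[of S f v]
      by (auto simp: x word_subst_cons_reduce[of S f] m_assoc)
  qed
  then show "word_subst G f (u \<otimes>\<^bsub>free_group S\<^esub> v) = word_subst G f u \<otimes> word_subst G f v"
    by (simp add: free_group_def)
qed

lemma (in group) word_subst_free_gen:
  "f a \<in> carrier G \<Longrightarrow> word_subst G f (free_gen a) = f a"
  by (simp add: free_gen_def)

lemma free_gen_closed: "a \<in> S \<Longrightarrow> free_gen a \<in> carrier (free_group S)"
  by (simp add: free_group_def free_gen_def reduced_def)

lemma inv_free_gen: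
  assumes "a \<in> S"
  shows "inv\<^bsub>free_group S\<^esub> free_gen a = [(a, False)]"
proof (rule group.inv_equality[OF group_free_group])
  show "[(a, False)] \<in> carrier (free_group S)"
    using assms by (simp add: free_group_def reduced_def)
qed (use assms in \<open>auto simp: free_group_def free_gen_def reduced_def cancels_def\<close>)

text \<open>A reduced word splits off its first letter without cancellation, and a single letter is
  a generator or the inverse of one.\<close>

lemma free_group_generated: "carrier (free_group S) = generate (free_group S) (free_gen ` S)"
proof
  show "generate (free_group S) (free_gen ` S) \<subseteq> carrier (free_group S)"
    by (intro group.generate_incl group_free_group) (auto intro: free_gen_closed)
  show "carrier (free_group S) \<subseteq> generate (free_group S) (free_gen ` S)"
  proof
    fix w assume "w \<in> carrier (free_group S)"
    then show "w \<in> generate (free_group S) (free_gen ` S)"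
    proof (induction w)
      case Nil
      then show ?case
        using generate.one[of "free_group S" "free_gen ` S"] by (simp add: free_group_def)
    next
      case (Cons x w)
      obtain a e where x: "x = (a, e)" by (cases x)
      have a: "a \<in> S" and red: "reduced (x # w)" and w: "w \<in> carrier (free_group S)"
        using Cons.prems reduced_ConsD by (auto simp: x free_group_def)
      have "[x] \<in> generate (free_group S) (free_gen ` S)"
      proof (cases e)
        case True
        then have "[x] = free_gen a" by (simp add: x free_gen_def)
        with a show ?thesis by (auto intro: generate.incl)
      next
        case False
        then have "[x] = inv\<^bsub>free_group S\<^esub> free_gen a" using inv_free_gen[OF a] by (simp add: x)
        with a show ?thesis by (auto intro: generate.inv)
      qed
      moreover have "x # w = [x] \<otimes>\<^bsub>free_group S\<^esub> w"
        using red by (cases w) (auto simp: free_group_def reduced_def)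
      ultimately show ?case using Cons.IH[OF w] by (metis generate.eng)
    qed
  qed
qed

section \<open>Normal closures and the universal property of a presentation\<close>

lemma (in group) normal_closure_normal:
  assumes "R \<subseteq> carrier G"
  shows "normal_closure G R \<lhd> G"
proof -
  \<comment> \<open>The family being intersected must be nonempty for its intersection to be a
    subgroup.\<close>
  have "carrier G \<in> {N. N \<lhd> G \<and> R \<subseteq> N}"
    using assms normal_self by simp
  then have "subgroup (normal_closure G R) G"
    unfolding normal_closure_def
    by (intro subgroups_Inter) (auto intro: normal_imp_subgroup)
  then show ?thesis
    unfolding normal_inv_iff by (auto simp: normal_closure_def normal_inv_iff)
qed

lemma subset_normal_closure: "R \<subseteq> normal_closure G R"
  by (auto simp: normal_closure_def)

lemma normal_closure_minimal: "N \<lhd> G \<Longrightarrow> R \<subseteq> N \<Longrightarrow> normal_closure G R \<subseteq> N"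
  by (auto simp: normal_closure_def)

definition presentation_map :: "'a set \<Rightarrow> 'a word set \<Rightarrow> 'a word \<Rightarrow> 'a word set" where
  "presentation_map S R x = normal_closure (free_group S) R #>\<^bsub>free_group S\<^esub> x"

definition abelianization_map :: "('a, 'b) monoid_scheme \<Rightarrow> 'a \<Rightarrow> 'a set" where
  "abelianization_map G x = derived G (carrier G) #>\<^bsub>G\<^esub> x"

lemma (in normal) r_coset_image: "(\<lambda>x. H #> x) ` carrier G = carrier (G Mod H)"
  by (auto simp: FactGroup_def RCOSETS_def)

lemma (in normal) r_coset_eq_one: "x \<in> H \<Longrightarrow> H #> x = \<one>\<^bsub>G Mod H\<^esub>"
  by (simp add: FactGroup_def coset_join2 is_subgroup mem_carrier)

context
  fixes S :: "'a set" and R :: "'a word set"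
  assumes R: "R \<subseteq> carrier (free_group S)"
begin

interpretation N: normal "normal_closure (free_group S) R" "free_group S"
  by (rule group.normal_closure_normal[OF group_free_group R])

lemma group_presented_group: "group (presented_group S R)"
  unfolding presented_group_def by (rule N.factorgroup_is_group)

lemma presentation_map_hom: "presentation_map S R \<in> hom (free_group S) (presented_group S R)"
  using N.r_coset_hom_Mod by (simp add: presentation_map_def[abs_def] presented_group_def)

lemma presentation_map_image:
  "presentation_map S R ` carrier (free_group S) = carrier (presented_group S R)"
  using N.r_coset_image by (simp add: presentation_map_def[abs_def] presented_group_def)

lemma presentation_map_relator: "r \<in> R \<Longrightarrow> presentation_map S R r = \<one>\<^bsub>presented_group S R\<^esub>"
  using N.r_coset_eq_one subset_normal_closure[of R "free_group S"]
  by (auto simp: presentation_map_def presented_group_def)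

text \<open>Von Dyck's theorem: the kernel of \<open>h\<close> is normal and contains
  \<open>R\<close>, hence contains the normal closure, so \<open>h\<close> factors through the
  quotient.\<close>

lemma presented_group_universal:
  assumes "group H" "h \<in> hom (free_group S) H" "\<And>r. r \<in> R \<Longrightarrow> h r = \<one>\<^bsub>H\<^esub>"
  obtains g where "g \<in> hom (presented_group S R) H"
    "\<And>x. x \<in> carrier (free_group S) \<Longrightarrow> g (presentation_map S R x) = h x"
proof -
  interpret h: group_hom "free_group S" H h
    using assms by (simp add: group_hom_def group_hom_axioms_def group_free_group)
  have "normal_closure (free_group S) R \<subseteq> kernel (free_group S) H h"
    using R assms(3) by (intro normal_closure_minimal h.normal_kernel) (auto simp: kernel_def)
  from h.FactGroup_universal_kernel[OF N.normal_axioms this] that show thesis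
    unfolding presented_group_def presentation_map_def by blast
qed

end

section \<open>Universal property of the abelianization\<close>

context group
begin

lemma comm_group_abelianization: "comm_group (abelianization G)"
  unfolding abelianization_def by (rule derived_quot_is_comm_group)

lemma abelianization_map_hom: "abelianization_map G \<in> hom G (abelianization G)"
  using normal.r_coset_hom_Mod[OF derived_self_is_normal]
  by (simp add: abelianization_map_def[abs_def] abelianization_def)

lemma abelianization_map_image: "abelianization_map G ` carrier G = carrier (abelianization G)"
  using normal.r_coset_image[OF derived_self_is_normal]
  by (simp add: abelianization_map_def[abs_def] abelianization_def)

lemma abelianization_universal:
  assumes "comm_group H" "h \<in> hom G H"
  obtains g where "g \<in> hom (abelianization G) H"
    "\<And>x. x \<in> carrier G \<Longrightarrow> g (abelianization_map G x) = h x"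
proof -
  interpret H: comm_group H by fact
  interpret h: group_hom G H h
    using assms by (simp add: group_hom_def group_hom_axioms_def H.group_axioms)
  \<comment> \<open>The image of the derived subgroup is the derived subgroup of the image, which is
    trivial because \<open>H\<close> is abelian.\<close>
  have "h ` derived G (carrier G) = {\<one>\<^bsub>H\<^esub>}"
    unfolding h.derived_img[OF order_refl, symmetric]
    by (rule H.derived_eq_singleton) auto
  then have "derived G (carrier G) \<subseteq> kernel G H h"
    using derived_in_carrier[OF order_refl] by (auto simp: kernel_def)
  from h.FactGroup_universal_kernel[OF derived_self_is_normal this] that show thesis
    unfolding abelianization_def abelianization_map_def by blast
qed

end


section \<open>The generators of the abelianized fractional Fibonacci group\<close>

definition Fibonacci_relator :: "nat \<Rightarrow> nat \<Rightarrow> nat \<Rightarrow> nat word" where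
  "Fibonacci_relator k n i =
     cyc_gen n i
     \<otimes>\<^bsub>free_group {..<n}\<^esub> (cyc_gen n (i + 1) [^]\<^bsub>free_group {..<n}\<^esub> k)
     \<otimes>\<^bsub>free_group {..<n}\<^esub> inv\<^bsub>free_group {..<n}\<^esub> (cyc_gen n (i + 2))"

lemma cyc_gen_closed: "n \<ge> 1 \<Longrightarrow> cyc_gen n i \<in> carrier (free_group {..<n})"
  by (simp add: cyc_gen_def free_gen_closed)

lemma Fibonacci_relator_closed: "n \<ge> 1 \<Longrightarrow> Fibonacci_relator k n i \<in> carrier (free_group {..<n})"
proof -
  interpret group "free_group {..<n}" by (rule group_free_group)
  show "n \<ge> 1 \<Longrightarrow> ?thesis" by (simp add: Fibonacci_relator_def cyc_gen_closed)
qed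

lemma hom_Fibonacci_relator:
  assumes "n \<ge> 1" "group H" "h \<in> hom (free_group {..<n}) H"
  shows "h (Fibonacci_relator k n i) =
    h (cyc_gen n i) \<otimes>\<^bsub>H\<^esub> h (cyc_gen n (i + 1)) [^]\<^bsub>H\<^esub> k \<otimes>\<^bsub>H\<^esub> inv\<^bsub>H\<^esub> h (cyc_gen n (i + 2))"
proof -
  interpret h: group_hom "free_group {..<n}" H h
    using assms by (simp add: group_hom_def group_hom_axioms_def group_free_group)
  show ?thesis
    using assms(1) by (simp add: Fibonacci_relator_def cyc_gen_closed h.hom_nat_pow)
qed

text \<open>Substituting shifted generators is an endomorphism of the free group, so it carries the
  relator at index 0 to the relator at index \<open>i\<close>.\<close>

lemma fractional_Fibonacci_group_presentation:
  assumes "n \<ge> 1"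
  shows "fractional_Fibonacci_group k n = presented_group {..<n} (Fibonacci_relator k n ` {..<n})"
proof -
  interpret F: group "free_group {..<n}" by (rule group_free_group)
  have "word_subst (free_group {..<n}) (\<lambda>j. cyc_gen n (i + j)) (Fibonacci_relator k n 0)
      = Fibonacci_relator k n i" for i
  proof -
    let ?h = "word_subst (free_group {..<n}) (\<lambda>j. cyc_gen n (i + j))"
    have "?h \<in> hom (free_group {..<n}) (free_group {..<n})"
      using assms by (intro F.word_subst_hom cyc_gen_closed)
    moreover have "?h (cyc_gen n j) = cyc_gen n (i + j)" for j
      using assms F.word_subst_free_gen[of "\<lambda>j. cyc_gen n (i + j)" "j mod n"]
      by (simp add: cyc_gen_closed cyc_gen_def[of n j]) (simp add: cyc_gen_def mod_simps)
    ultimately show ?thesis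
      using assms hom_Fibonacci_relator[of n "free_group {..<n}" ?h k 0]
      by (simp add: F.group_axioms) (simp add: Fibonacci_relator_def)
  qed
  moreover have "fractional_Fibonacci_group k n =
      cyclically_presented_group n (Fibonacci_relator k n 0)"
    by (simp only: fractional_Fibonacci_group_def Fibonacci_relator_def add_0)
  ultimately show ?thesis
    by (simp add: cyclically_presented_group_def)
qed

text \<open>The image of x_i in the abelianization. The index runs over all naturals, so that the
  cyclic generators become a periodic sequence and the recurrence needs no wrap-around.\<close>

definition Fibonacci_ab_gen :: "nat \<Rightarrow> nat \<Rightarrow> nat \<Rightarrow> nat word set set" where
  "Fibonacci_ab_gen k n i =
     abelianization_map (fractional_Fibonacci_group k n)
       (presentation_map {..<n} (Fibonacci_relator k n ` {..<n}) (cyc_gen n i))"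

lemma periodic_mod:
  assumes "\<And>i. f (i + n) = f i"
  shows "f (i mod n) = f (i::nat)"
proof -
  have "f (j + m * n) = f j" for j m
    by (induction m) (auto simp: assms add.assoc[symmetric] add.commute[of n])
  from this[of "i mod n" "i div n"] show ?thesis by simp
qed

section \<open>The abelianization as the universal abelian group with an \<open>n\<close>-periodic
  solution of the recurrence\<close>

context
  fixes k n :: nat
  assumes n: "n \<ge> 1"
begin

private abbreviation (input) "F \<equiv> free_group {..<n}"
private abbreviation (input) "R \<equiv> Fibonacci_relator k n ` {..<n}"
private abbreviation (input) "P \<equiv> fractional_Fibonacci_group k n"
private abbreviation (input) "A \<equiv> abelianization (fractional_Fibonacci_group k n)"
private abbreviation (input) "\<xi> \<equiv> Fibonacci_ab_gen k n"
private abbreviation (input) "\<pi> \<equiv> abelianization_map P \<circ> presentation_map {..<n} R"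

lemma relators_closed: "R \<subseteq> carrier F"
  using n by (auto intro: Fibonacci_relator_closed)

lemma group_fractional_Fibonacci_group: "group P"
  by (simp add: fractional_Fibonacci_group_presentation[OF n] group_presented_group[OF relators_closed])

interpretation F: group F by (rule group_free_group)
interpretation P: group P by (rule group_fractional_Fibonacci_group)
interpretation A: comm_group A by (rule P.comm_group_abelianization)

private lemma presentation_hom: "presentation_map {..<n} R \<in> hom F P"
  using presentation_map_hom[OF relators_closed]
  by (simp add: fractional_Fibonacci_group_presentation[OF n])

private lemma pi_hom: "\<pi> \<in> hom F A"
  using presentation_hom P.abelianization_map_hom by (rule hom_compose)

private lemma pi_image: "\<pi> ` carrier F = carrier A"
  using presentation_map_image[OF relators_closed] P.abelianization_map_image
  by (simp only: image_comp[symmetric] fractional_Fibonacci_group_presentation[OF n])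

interpretation pi: group_hom F A \<pi>
  using pi_hom by (simp add: group_hom_def group_hom_axioms_def F.group_axioms A.group_axioms)

lemma Fibonacci_ab_gen_closed: "\<xi> i \<in> carrier A"
  using pi.hom_closed[of "cyc_gen n i"] n by (simp add: cyc_gen_closed Fibonacci_ab_gen_def)

lemma Fibonacci_ab_gen_periodic: "\<xi> (i + n) = \<xi> i"
  by (simp add: Fibonacci_ab_gen_def cyc_gen_def)

lemma Fibonacci_ab_gen_rec: "\<xi> (i + 2) = \<xi> i \<otimes>\<^bsub>A\<^esub> \<xi> (i + 1) [^]\<^bsub>A\<^esub> k"
proof -
  have rel: "\<xi> j \<otimes>\<^bsub>A\<^esub> \<xi> (j + 1) [^]\<^bsub>A\<^esub> k \<otimes>\<^bsub>A\<^esub> inv\<^bsub>A\<^esub> \<xi> (j + 2) = \<one>\<^bsub>A\<^esub>" if "j < n" for j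
  proof -
    have "presentation_map {..<n} R (Fibonacci_relator k n j) = \<one>\<^bsub>P\<^esub>"
      using presentation_map_relator[OF relators_closed] that
      by (simp add: fractional_Fibonacci_group_presentation[OF n])
    then have "\<pi> (Fibonacci_relator k n j) = \<one>\<^bsub>A\<^esub>"
      using hom_one[OF P.abelianization_map_hom P.group_axioms A.group_axioms] by simp
    then show ?thesis
      using hom_Fibonacci_relator[OF n A.group_axioms pi_hom] by (simp add: Fibonacci_ab_gen_def)
  qed
  \<comment> \<open>Relators are given only below \<open>n\<close>; periodicity moves the relation
    at \<open>i mod n\<close> to an arbitrary index \<open>i\<close>.\<close>
  have eq: "\<xi> (i mod n + j) = \<xi> (i + j)" for j
    by (simp add: Fibonacci_ab_gen_def cyc_gen_def mod_simps)
  have "\<xi> i \<otimes>\<^bsub>A\<^esub> \<xi> (i + 1) [^]\<^bsub>A\<^esub> k \<otimes>\<^bsub>A\<^esub> inv\<^bsub>A\<^esub> \<xi> (i + 2) = \<one>\<^bsub>A\<^esub>"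
    using rel[of "i mod n"] n eq[of 0] eq[of 1] eq[of 2] by simp
  then show ?thesis
    using A.inv_solve_right[of "\<one>\<^bsub>A\<^esub>"] A.inv_equality A.inv_inv
    by (metis A.inv_closed A.m_closed A.nat_pow_closed Fibonacci_ab_gen_closed)
qed

lemma Fibonacci_ab_gen_generate: "carrier A = generate A (range \<xi>)"
proof
  have "carrier A = \<pi> ` generate F (free_gen ` {..<n})"
    by (simp only: pi_image[symmetric] free_group_generated[symmetric])
  also have "\<dots> = generate A (\<pi> ` free_gen ` {..<n})"
    by (rule pi.generate_img[symmetric]) (auto intro: free_gen_closed)
  also have "\<dots> \<subseteq> generate A (range \<xi>)"
  proof (rule A.mono_generate)
    have "\<pi> (free_gen i) = \<xi> i" if "i < n" for i
      using that by (simp add: Fibonacci_ab_gen_def cyc_gen_def)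
    then show "\<pi> ` free_gen ` {..<n} \<subseteq> range \<xi>" by auto
  qed
  finally show "carrier A \<subseteq> generate A (range \<xi>)" .
  show "generate A (range \<xi>) \<subseteq> carrier A"
    by (intro A.generate_incl) (auto intro: Fibonacci_ab_gen_closed)
qed

text \<open>The recurrence for \<open>f\<close> makes the substitution homomorphism kill every
  relator; it then factors first through the presented group and, as \<open>H\<close> is abelian,
  through the abelianization.\<close>

lemma Fibonacci_ab_gen_universal:
  assumes "comm_group H" and f: "\<And>i. f i \<in> carrier H" "\<And>i. f (i + n) = f i"
    "\<And>i. f (i + 2) = f i \<otimes>\<^bsub>H\<^esub> f (i + 1) [^]\<^bsub>H\<^esub> k"
  obtains g where "g \<in> hom A H" "\<And>i. g (\<xi> i) = f i"
proof -
  interpret H: comm_group H by fact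
  let ?h = "word_subst H f"
  have h: "?h \<in> hom F H"
    by (rule H.word_subst_hom) (rule f)
  have h_gen: "?h (cyc_gen n i) = f i" for i
    by (simp add: cyc_gen_def H.word_subst_free_gen f periodic_mod[of f n])
  have "?h r = \<one>\<^bsub>H\<^esub>" if "r \<in> R" for r
  proof -
    from that obtain i where "r = Fibonacci_relator k n i" by auto
    then have "?h r = f i \<otimes>\<^bsub>H\<^esub> f (i + 1) [^]\<^bsub>H\<^esub> k \<otimes>\<^bsub>H\<^esub> inv\<^bsub>H\<^esub> f (i + 2)"
      using hom_Fibonacci_relator[OF n H.group_axioms h] by (simp only: h_gen)
    then show ?thesis by (simp only: f(3)[symmetric] H.r_inv f(1))
  qed
  then obtain g1 where g1: "g1 \<in> hom P H"
      "\<And>x. x \<in> carrier F \<Longrightarrow> g1 (presentation_map {..<n} R x) = ?h x"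
    using presented_group_universal[OF relators_closed H.group_axioms h]
    by (metis fractional_Fibonacci_group_presentation[OF n])
  from P.abelianization_universal[OF assms(1) g1(1)]
  obtain g where g: "g \<in> hom A H" "\<And>x. x \<in> carrier P \<Longrightarrow> g (abelianization_map P x) = g1 x"
    by blast
  have "g (\<xi> i) = f i" for i
    using g(2) g1(2) h_gen n hom_in_carrier[OF presentation_hom]
    by (simp add: Fibonacci_ab_gen_def cyc_gen_closed)
  with g(1) that show thesis by blast
qed

end


section \<open>Linear recurrences and the relation lattice\<close>

text \<open>Supplies the positivity of \<alpha> and the nonnegativity of \<open>N\<close> in the
  theorem.\<close>

lemma frac_fib_ge_1: "k \<ge> 1 \<Longrightarrow> frac_fib k (Suc j) \<ge> 1"
proof (induction k "Suc j" arbitrary: j rule: frac_fib.induct)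
  case (3 k j)
  have "frac_fib k j \<ge> 0" using 3 by (cases j) force+
  moreover have "int k * frac_fib k (Suc j) \<ge> 1 * 1"
    using 3 by (intro mult_mono) auto
  ultimately show ?case by simp
qed auto

text \<open>Later identifies \<open>N\<close> with the negative of the determinant of the relation
  lattice.\<close>

lemma frac_fib_cassini:
  "frac_fib k j * frac_fib k (Suc (Suc j)) - frac_fib k (Suc j) ^ 2 = (-1) ^ Suc j"
  by (induction j) (auto simp: algebra_simps power2_eq_square)

text \<open>The differences \<open>h (i + n) - h i\<close> satisfy the same second-order recurrence,
  so divisibility of two consecutive ones propagates.\<close>

lemma dvd_linear_recurrence_shift:
  fixes h :: "nat \<Rightarrow> int"
  assumes "\<And>i. h (i + 2) = h i + k * h (i + 1)" "m dvd h n - h 0" "m dvd h (n + 1) - h 1"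
  shows "m dvd h (i + n) - h i"
proof -
  have "m dvd h (i + n) - h i \<and> m dvd h (i + 1 + n) - h (i + 1)"
  proof (induction i)
    case 0
    then show ?case using assms(2,3) by simp
  next
    case (Suc i)
    have "h (i + 2 + n) - h (i + 2) = (h (i + n) - h i) + k * (h (i + 1 + n) - h (i + 1))"
      using assms(1)[of i] assms(1)[of "i + n"] by (simp add: algebra_simps)
    then show ?case using Suc by (simp add: dvd_add)
  qed
  then show ?thesis by blast
qed

text \<open>The exponent \<open>F\<^bsub>i+1\<^esub> - k F\<^sub>i\<close> is \<open>F\<^bsub>i-1\<^esub>\<close>, in a form that is also meaningful for \<open>i = 0\<close>.\<close>

lemma (in comm_group) linear_recurrence_closed_form:
  assumes cl: "\<And>i. x i \<in> carrier G"
    and rec: "\<And>i. x (i + 2) = x i \<otimes> x (i + 1) [^] k"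
  shows "x i = x 0 [^] (frac_fib k (Suc i) - int k * frac_fib k i) \<otimes> x 1 [^] frac_fib k i"
proof (induction i rule: induct_nat_012)
  case 0
  then show ?case using cl by simp
next
  case 1
  then show ?case using cl by simp
next
  case (ge2 i)
  let ?e = "\<lambda>i. frac_fib k (Suc i) - int k * frac_fib k i"
  have cl': "x j [^] (m::int) \<in> carrier G" for j m using cl by simp
  have "x (Suc (Suc i)) = x i \<otimes> x (Suc i) [^] int k"
    using rec[of i] by (simp add: int_pow_int)
  also have "\<dots> = (x 0 [^] ?e i \<otimes> x 1 [^] frac_fib k i)
      \<otimes> (x 0 [^] (?e (Suc i) * int k) \<otimes> x 1 [^] (frac_fib k (Suc i) * int k))"
    by (subst ge2(1), subst ge2(2)) (simp only: int_pow_distrib[OF cl' cl'] int_pow_pow[OF cl])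
  also have "\<dots> = x 0 [^] (?e i + ?e (Suc i) * int k)
      \<otimes> x 1 [^] (frac_fib k i + frac_fib k (Suc i) * int k)"
    by (simp only: int_pow_mult[OF cl] m_ac cl' m_closed)
  finally show ?case by (simp add: algebra_simps)
qed

text \<open>By commutativity these products already form a subgroup; it provides the coordinates in
  which the relation lattice is expressed.\<close>

lemma (in comm_group) generate_pair:
  assumes x: "x \<in> carrier G" and y: "y \<in> carrier G"
  shows "generate G {x, y} = {x [^] p \<otimes> y [^] q | (p::int) (q::int). True}" (is "_ = ?L")
proof
  have mult: "(x [^] p \<otimes> y [^] q) \<otimes> (x [^] p' \<otimes> y [^] q') = x [^] (p + p') \<otimes> y [^] (q + q')"
    for p q p' q' :: int
    using x y by (simp add: int_pow_mult m_ac)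
  have "subgroup ?L G"
  proof (rule subgroupI)
    show "?L \<subseteq> carrier G" using x y by auto
    show "?L \<noteq> {}" by auto
    show "inv a \<in> ?L" if "a \<in> ?L" for a
    proof -
      from that obtain p q :: int where a: "a = x [^] p \<otimes> y [^] q" by auto
      have "inv a = x [^] (-p) \<otimes> y [^] (-q)"
        using x y by (simp add: a inv_mult int_pow_neg)
      then show ?thesis by blast
    qed
    show "a \<otimes> b \<in> ?L" if "a \<in> ?L" "b \<in> ?L" for a b
      using that mult by blast
  qed
  moreover have "x \<in> ?L" "y \<in> ?L"
  proof -
    have "x = x [^] (1::int) \<otimes> y [^] (0::int)" "y = x [^] (0::int) \<otimes> y [^] (1::int)"
      using x y by simp_all
    then show "x \<in> ?L" "y \<in> ?L" by blast+
  qed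
  ultimately show "generate G {x, y} \<subseteq> ?L"
    by (intro generate_subgroup_incl) auto
  have sub: "subgroup (generate G {x, y}) G"
    using x y by (intro generate_is_subgroup) auto
  have "x [^] p \<in> generate G {x, y}" "y [^] p \<in> generate G {x, y}" for p :: int
    using subgroup_int_pow_closed[OF sub] by (auto intro: generate.incl)
  then show "?L \<subseteq> generate G {x, y}"
    by (auto intro: generate.eng)
qed

text \<open>The hypotheses are divisibility conditions on the coordinates of \<open>(x, y)\<close> in the basis \<open>(c, d), (-v, u)\<close> of \<open>\<int>\<^sup>2\<close>.\<close>

lemma mem_relation_lattice:
  fixes a b c d u v x y k \<alpha> :: int
  assumes "u * c + v * d = 1"
    and "\<alpha> dvd x * u + y * v"
    and "\<alpha> * (d * d - c * (k * d + c)) dvd y * c - x * d"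
  obtains s t where "x = s * (\<alpha> * c) + t * (\<alpha> * d)"
    and "y = s * (\<alpha> * d) + t * (k * (\<alpha> * d) + \<alpha> * c)"
proof -
  obtain s0 where s0: "x * u + y * v = \<alpha> * s0" using assms(2) by auto
  let ?D = "d * d - c * (k * d + c)"
  obtain t0 where t0: "y * c - x * d = \<alpha> * ?D * t0" using assms(3) by auto
  \<comment> \<open>In the basis \<open>(c, d), (-v, u)\<close>, the first lattice vector has
    coordinates \<open>(\<alpha>, 0)\<close> and the second
    \<open>(\<alpha> * r, - \<alpha> * ?D)\<close>. Matching
    \<open>(\<alpha> * s0, \<alpha> * ?D * t0)\<close> forces \<open>t = - t0\<close> and then
    \<open>s = s0 + r * t0\<close>.\<close>
  define r where "r = d * u + (k * d + c) * v"
  have uc: "u * c = 1 - v * d" and vd: "v * d = 1 - u * c" using assms(1) by simp_all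
  have "r * c = d * (u * c) + (k * d + c) * v * c" by (simp add: r_def algebra_simps)
  then have rc: "r * c = d - v * ?D" unfolding uc by (simp add: algebra_simps)
  have "r * d = d * u * d + (k * d + c) * (v * d)" by (simp add: r_def algebra_simps)
  then have rd: "r * d = k * d + c + u * ?D" unfolding vd by (simp add: algebra_simps)
  have "x = x * (u * c + v * d)" using assms(1) by simp
  also have "\<dots> = (x * u + y * v) * c - v * (y * c - x * d)" by (simp add: algebra_simps)
  also have "\<dots> = \<alpha> * s0 * c + \<alpha> * t0 * (r * c - d)"
    unfolding s0 t0 rc by (simp add: algebra_simps)
  finally have x: "x = (s0 + r * t0) * (\<alpha> * c) + (- t0) * (\<alpha> * d)"
    by (simp add: algebra_simps)
  have "y = y * (u * c + v * d)" using assms(1) by simp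
  also have "\<dots> = (x * u + y * v) * d + u * (y * c - x * d)" by (simp add: algebra_simps)
  also have "\<dots> = \<alpha> * s0 * d + \<alpha> * t0 * (r * d - (k * d + c))"
    unfolding s0 t0 rd by (simp add: algebra_simps)
  finally have "y = (s0 + r * t0) * (\<alpha> * d) + (- t0) * (k * (\<alpha> * d) + \<alpha> * c)"
    by (simp add: algebra_simps)
  with x show thesis by (rule that)
qed

lemma mod_closed_integer_mod_group: "x mod int m \<in> carrier (integer_mod_group m)"
  by (simp add: carrier_integer_mod_group)

text \<open>Reduces a homomorphism to a cyclic group to two congruences on an integer sequence. The
  case \<open>m = 0\<close> is included: the target is then the integers and reduction mod 0 is the
  identity.\<close>

lemma Fibonacci_ab_gen_hom_integer_mod_group:
  fixes h :: "nat \<Rightarrow> int"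
  assumes n: "n \<ge> 1" and rec: "\<And>i. h (i + 2) = h i + int k * h (i + 1)"
    and dvd: "int m dvd h n - h 0" "int m dvd h (n + 1) - h 1"
  obtains g where
    "g \<in> hom (abelianization (fractional_Fibonacci_group k n)) (integer_mod_group m)"
    "\<And>i. g (Fibonacci_ab_gen k n i) = h i mod int m"
proof (rule Fibonacci_ab_gen_universal[OF n, of "integer_mod_group m" "\<lambda>i. h i mod int m" k])
  show "h (i + n) mod int m = h i mod int m" for i
    using dvd_linear_recurrence_shift[OF rec dvd] by (simp add: mod_eq_dvd_iff)
  show "h (i + 2) mod int m = h i mod int m \<otimes>\<^bsub>integer_mod_group m\<^esub>
      (h (i + 1) mod int m) [^]\<^bsub>integer_mod_group m\<^esub> k" for i
    by (simp only: rec) (simp add: mod_simps)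
qed (auto simp: mod_closed_integer_mod_group intro: that)


theorem theorem4p2:
  fixes n k :: nat
  assumes "n \<ge> 1" and "k \<ge> 1"
  shows "let \<alpha> = gcd (frac_fib k n) (frac_fib k (n - 1) - 1);
             N = frac_fib k (n + 1) + frac_fib k (n - 1) - 1 - (-1) ^ n
         in \<alpha> dvd N \<and>
            abelianization (fractional_Fibonacci_group k n) \<cong>
              integer_mod_group (nat \<alpha>) \<times>\<times> integer_mod_group (nat (N div \<alpha>))"
proof -
  define a b where "a = frac_fib k (n - 1) - 1" and "b = frac_fib k n"
  define \<alpha> where "\<alpha> = gcd b a"
  define N where "N = frac_fib k (n + 1) + frac_fib k (n - 1) - 1 - (-1) ^ n"
  obtain m where m: "n = Suc m" using assms(1) by (cases n) auto
  have "b \<ge> 1" using frac_fib_ge_1[OF assms(2)] by (simp add: b_def m)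
  then have \<alpha>_pos: "\<alpha> > 0" by (simp add: \<alpha>_def)
  \<comment> \<open>Exponents of x_0 and x_1 in the closed forms of x_n and x_{n+1}; subtracting
    those of x_0 and x_1 leaves the lattice vectors.\<close>
  have coeff_n: "frac_fib k (Suc n) - int k * frac_fib k n = a + 1" "frac_fib k n = b"
    and coeff_Suc: "frac_fib k (Suc (Suc n)) - int k * frac_fib k (Suc n) = b"
      "frac_fib k (Suc n) = int k * b + a + 1"
    by (simp_all add: a_def b_def m)
  have "\<alpha> dvd a" "\<alpha> dvd b" by (simp_all add: \<alpha>_def)
  then obtain c d where c: "a = \<alpha> * c" and d: "b = \<alpha> * d" by (auto elim!: dvdE)
  obtain v u where "v * b + u * a = \<alpha>"
    using bezout_int[of b a] by (auto simp: \<alpha>_def)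
  then have "\<alpha> * (u * c + v * d) = \<alpha> * 1" by (simp add: c d algebra_simps)
  then have uv: "u * c + v * d = 1" using \<alpha>_pos by simp
  \<comment> \<open>Cassini's identity at \<open>m = n - 1\<close> reads F_{n-1} F_{n+1} - F_n^2 =
    (-1)^n.\<close>
  have "N = b * b - a * (int k * b + a)"
    using frac_fib_cassini[of k m]
    by (simp add: N_def a_def b_def m power2_eq_square algebra_simps)
  then have N: "N = \<alpha> * (\<alpha> * (d * d - c * (int k * d + c)))"
    by (simp add: c d algebra_simps)
  \<comment> \<open>Makes \<beta> nonnegative, so that \<open>nat \<beta>\<close> keeps its value.
    For \<open>n = 1\<close> the term F_{n-1} vanishes, and there \<open>N = k\<close>.\<close>
  have "N \<ge> 0"
  proof (cases m)
    case 0
    then show ?thesis by (simp add: N_def m)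
  next
    case (Suc l)
    have "frac_fib k m \<ge> 1" "frac_fib k (n + 1) \<ge> 1" "(-1) ^ n \<le> (1::int)"
      using frac_fib_ge_1[OF assms(2)] by (simp_all add: Suc power_le_one_iff minus_one_power_iff del: frac_fib.simps)
    then show ?thesis by (simp add: N_def m del: frac_fib.simps)
  qed
  define \<beta> where "\<beta> = N div \<alpha>"
  have \<beta>: "\<beta> = \<alpha> * (d * d - c * (int k * d + c))"
    using \<alpha>_pos by (simp add: \<beta>_def N)
  have "\<beta> \<ge> 0" using \<open>N \<ge> 0\<close> \<alpha>_pos by (simp add: \<beta>_def pos_imp_zdiv_nonneg_iff)
  let ?A = "abelianization (fractional_Fibonacci_group k n)"
  let ?x = "Fibonacci_ab_gen k n"
  let ?H = "integer_mod_group (nat \<alpha>)" and ?K = "integer_mod_group (nat \<beta>)"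
  interpret A: comm_group ?A
    by (intro group.comm_group_abelianization group_fractional_Fibonacci_group assms(1))
  have x_closed: "?x i \<in> carrier ?A" for i
    by (rule Fibonacci_ab_gen_closed[OF assms(1)])
  \<comment> \<open>The surjection from pairs of integers onto the group; its kernel will turn out
    to be the relation lattice.\<close>
  define \<chi> where "\<chi> = (\<lambda>(p::int) (q::int). ?x 0 [^]\<^bsub>?A\<^esub> p \<otimes>\<^bsub>?A\<^esub> ?x 1 [^]\<^bsub>?A\<^esub> q)"
  have \<chi>_closed: "\<chi> p q \<in> carrier ?A" for p q
    by (simp add: \<chi>_def x_closed)
  have \<chi>_add: "\<chi> (p + p') (q + q') = \<chi> p q \<otimes>\<^bsub>?A\<^esub> \<chi> p' q'" for p q p' q'
    by (simp add: \<chi>_def x_closed A.int_pow_mult A.m_ac)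
  have \<chi>_pow: "\<chi> (s * p) (s * q) = \<chi> p q [^]\<^bsub>?A\<^esub> s" for p q s
    by (simp add: \<chi>_def x_closed A.int_pow_distrib A.int_pow_pow mult.commute[of s])
  have x_eq: "?x i = \<chi> (frac_fib k (Suc i) - int k * frac_fib k i) (frac_fib k i)" for i
    unfolding \<chi>_def
    by (rule A.linear_recurrence_closed_form[OF x_closed Fibonacci_ab_gen_rec[OF assms(1)]])
  have \<chi>_1: "\<chi> 1 0 = ?x 0" "\<chi> 0 1 = ?x 1" by (simp_all add: \<chi>_def x_closed)
  have \<chi>_surj: "\<exists>p q. z = \<chi> p q" if "z \<in> carrier ?A" for z
  proof -
    have "carrier ?A = generate ?A (range ?x)"
      by (rule Fibonacci_ab_gen_generate[OF assms(1)])
    also have "\<dots> \<subseteq> generate ?A {?x 0, ?x 1}"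
    proof (rule A.generate_subgroup_incl)
      show "range ?x \<subseteq> generate ?A {?x 0, ?x 1}"
        using x_eq unfolding A.generate_pair[OF x_closed x_closed] \<chi>_def by blast
      show "subgroup (generate ?A {?x 0, ?x 1}) ?A"
        using x_closed by (intro A.generate_is_subgroup) auto
    qed
    finally show ?thesis
      using that unfolding A.generate_pair[OF x_closed x_closed] \<chi>_def by blast
  qed
  \<comment> \<open>Periodicity at indices 0 and 1 says that \<chi> sends both lattice vectors to
    the identity.\<close>
  have "?x (0 + n) = ?x 0" "?x (1 + n) = ?x 1"
    by (rule Fibonacci_ab_gen_periodic[OF assms(1)])+
  then have "\<chi> (a + 1) b = \<chi> 1 0" "\<chi> b (int k * b + a + 1) = \<chi> 0 1"
    using x_eq[of n, unfolded coeff_n(1), unfolded coeff_n(2)] x_eq[of "Suc n", unfolded coeff_Suc(1), unfolded coeff_Suc]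
    by (simp_all add: \<chi>_1)
  then have "\<chi> a b \<otimes>\<^bsub>?A\<^esub> \<chi> 1 0 = \<chi> 1 0" "\<chi> b (int k * b + a) \<otimes>\<^bsub>?A\<^esub> \<chi> 0 1 = \<chi> 0 1"
    by (simp_all flip: \<chi>_add)
  then have \<chi>_relations: "\<chi> a b = \<one>\<^bsub>?A\<^esub>" "\<chi> b (int k * b + a) = \<one>\<^bsub>?A\<^esub>"
    using A.r_cancel_one'[OF \<chi>_closed \<chi>_closed] A.r_cancel_one \<chi>_closed by metis+
  define h1 where "h1 i = (frac_fib k (Suc i) - int k * frac_fib k i) * u + frac_fib k i * v" for i
  define h2 where "h2 i = frac_fib k i * c - (frac_fib k (Suc i) - int k * frac_fib k i) * d" for i
  have h1_01: "h1 0 = u" "h1 1 = v" and h2_01: "h2 0 = - d" "h2 1 = c"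
    by (simp_all add: h1_def h2_def)
  \<comment> \<open>These differences are the values of the first form on the two lattice vectors,
    both multiples of \<alpha>. The second form gives 0 and \<open>- \<beta>\<close>.\<close>
  have h1_n: "h1 n - h1 0 = \<alpha>" "h1 (n + 1) - h1 1 = \<alpha> * (d * u + (int k * d + c) * v)"
  proof -
    show "h1 n - h1 0 = \<alpha>"
      using \<open>v * b + u * a = \<alpha>\<close> unfolding h1_01(1) unfolding h1_def coeff_n(1) unfolding coeff_n(2) by (simp add: algebra_simps)
    show "h1 (n + 1) - h1 1 = \<alpha> * (d * u + (int k * d + c) * v)"
      unfolding h1_01(2) unfolding h1_def add_0_right Suc_eq_plus1[symmetric] coeff_Suc(1)
      unfolding coeff_Suc(2) by (simp add: c d algebra_simps)
  qed
  have h2_n: "h2 n - h2 0 = 0" "h2 (n + 1) - h2 1 = - \<beta>"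
  proof -
    show "h2 n - h2 0 = 0"
      unfolding h2_01(1) unfolding h2_def coeff_n(1) unfolding coeff_n(2) by (simp add: c d algebra_simps)
    show "h2 (n + 1) - h2 1 = - \<beta>"
      unfolding h2_01(2) unfolding h2_def add_0_right Suc_eq_plus1[symmetric] coeff_Suc(1)
      unfolding coeff_Suc(2) \<beta> by (simp add: c d algebra_simps)
  qed
  have h1_rec: "h1 (i + 2) = h1 i + int k * h1 (i + 1)" for i
    by (simp add: h1_def algebra_simps)
  have "\<alpha> dvd h1 n - h1 0" "\<alpha> dvd h1 (n + 1) - h1 1"
    unfolding h1_n by simp_all
  then obtain g1 where g1: "g1 \<in> hom ?A ?H" "\<And>i. g1 (?x i) = h1 i mod \<alpha>"
    using Fibonacci_ab_gen_hom_integer_mod_group[OF assms(1) h1_rec, of "nat \<alpha>"]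
      \<alpha>_pos by (auto simp del: One_nat_def)
  have h2_rec: "h2 (i + 2) = h2 i + int k * h2 (i + 1)" for i
    by (simp add: h2_def algebra_simps)
  have "\<beta> dvd h2 n - h2 0" "\<beta> dvd h2 (n + 1) - h2 1"
    unfolding h2_n by simp_all
  then obtain g2 where g2: "g2 \<in> hom ?A ?K" "\<And>i. g2 (?x i) = h2 i mod \<beta>"
    using Fibonacci_ab_gen_hom_integer_mod_group[OF assms(1) h2_rec, of "nat \<beta>"]
      \<open>\<beta> \<ge> 0\<close> by (auto simp del: One_nat_def)
  interpret g1: group_hom ?A ?H g1
    using g1(1) by (simp add: group_hom_def group_hom_axioms_def A.group_axioms)
  interpret g2: group_hom ?A ?K g2
    using g2(1) by (simp add: group_hom_def group_hom_axioms_def A.group_axioms)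
  have g1_\<chi>: "g1 (\<chi> p q) = (p * u + q * v) mod \<alpha>" for p q
    using \<alpha>_pos
    by (simp add: \<chi>_def x_closed g1.hom_int_pow g1(2) int_pow_integer_mod_group h1_01[simplified] mod_simps)
  have g2_\<chi>: "g2 (\<chi> p q) = (q * c - p * d) mod \<beta>" for p q
    using \<open>\<beta> \<ge> 0\<close>
    by (simp add: \<chi>_def x_closed g2.hom_int_pow g2(2) int_pow_integer_mod_group h2_01[simplified] mod_simps)
  let ?g = "\<lambda>x. (g1 x, g2 x)"
  interpret g: group_hom ?A "?H \<times>\<times> ?K" ?g
    using g1(1) g2(1)
    by (simp add: group_hom_def group_hom_axioms_def A.group_axioms DirProd_group hom_pairwise o_def)
  have "?g \<in> iso ?A (?H \<times>\<times> ?K)"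
    unfolding g.iso_iff
  proof (intro conjI ballI impI subsetI)
    fix y assume "y \<in> carrier (?H \<times>\<times> ?K)"
    then obtain y1 y2 where y: "y = (y1, y2)" "y1 \<in> carrier ?H" "y2 \<in> carrier ?K" by auto
    \<comment> \<open>The two forms have determinant \<open>u * c + v * d = 1\<close>; this is the
      inverse change of coordinates.\<close>
    let ?p = "y1 * c - y2 * v" and ?q = "y1 * d + y2 * u"
    have "?p * u + ?q * v = y1 * (u * c + v * d)" "?q * c - ?p * d = y2 * (u * c + v * d)"
      by (simp_all add: algebra_simps)
    then have "g1 (\<chi> ?p ?q) = y1 mod \<alpha>" "g2 (\<chi> ?p ?q) = y2 mod \<beta>"
      unfolding uv g1_\<chi> g2_\<chi> by simp_all
    moreover have "y1 mod \<alpha> = y1" "y2 mod \<beta> = y2"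
      using y(2,3) \<alpha>_pos \<open>\<beta> \<ge> 0\<close> by (auto simp: carrier_integer_mod_group split: if_splits)
    ultimately have "?g (\<chi> ?p ?q) = y" using y(1) by simp
    then show "y \<in> ?g ` carrier ?A" using \<chi>_closed by blast
  next
    fix z assume z: "z \<in> carrier ?A" "?g z = \<one>\<^bsub>?H \<times>\<times> ?K\<^esub>"
    then obtain p q where pq: "z = \<chi> p q" using \<chi>_surj by blast
    \<comment> \<open>A trivial image under both forms puts \<open>(p, q)\<close> in the relation
      lattice, which \<chi> kills.\<close>
    have "\<alpha> dvd p * u + q * v" "\<beta> dvd q * c - p * d"
      using z(2) by (simp_all add: pq g1_\<chi> g2_\<chi> mod_eq_0_iff_dvd)
    then obtain s t where "p = s * a + t * b" "q = s * b + t * (int k * b + a)"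
      using mem_relation_lattice[OF uv, of \<alpha> p q "int k"] unfolding \<beta> c d by blast
    then have "z = \<chi> a b [^]\<^bsub>?A\<^esub> s \<otimes>\<^bsub>?A\<^esub> \<chi> b (int k * b + a) [^]\<^bsub>?A\<^esub> t"
      by (simp only: pq \<chi>_add \<chi>_pow)
    then show "z = \<one>\<^bsub>?A\<^esub>" by (simp add: \<chi>_relations)
  qed
  then have "?A \<cong> ?H \<times>\<times> ?K" by (rule is_isoI)
  moreover have "\<alpha> dvd N" by (simp add: N)
  ultimately show ?thesis
    by (simp add: Let_def \<alpha>_def \<beta>_def N_def a_def b_def)
qed

end
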